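(* Let $G\subset\mathbb{R}^3$ be a domain containing an incompressible fluid of viscosity $\nu$ which has a smooth laminar flow of constant velocity $u_a=u_a(x,0)$ for all $x\in G$ ($a=1,2,3$). Then $u_a$ trivially satisfies the Navier-Stokes equations with vanishing pressure gradient $\nabla_bp=0$, so that $\partial_tu_a+u^b\nabla_bu_a-\nu\Delta u_a=0$. The Reynolds number throughout $G$ is the constant $\mathsf{RE}=\|u_a\|L/\nu$, and it is taken to be high in that $\mathsf{RE}\gg\mathsf{RE}_*$, where $\mathsf{RE}_*$ is a critical Reynolds number. Let $\mathscr{U}_a$ be the randomly perturbed or turbulent flow obtained by mixing the smooth flow with a Gaussian random field $\mathscr{T}$ with kernel $K(x,y;\lambda)$ (see the context): $$\mathscr{U}_a(x,t)=u_a+A\,u_a(\mathsf{RE}-\mathsf{RE}_* )^{\beta}\,\mathscr{T}(x)=u_a+A\,u_a(\mathsf{RE}-\mathsf{RE}_* )^{\beta}\sum_{I=1}^\infty Z_I^{1/2}f_I(x)\,\xi_I ,$$ with $\beta=\tfrac12$ and $A$ a constant. Then this turbulent flow satisfies the stochastically averaged PDE $$\mathbb{E}\Big[\partial_t\mathscr{U}_a(x)+\mathscr{U}^b(x)\nabla_b\mathscr{U}_a(x)-\nu\Delta\mathscr{U}_a(x)\Big] =A^2u^bu_a(\mathsf{RE}-\mathsf{RE}_* )^{\beta}\sum_{I=1}^\infty Z_I^{1/2}f_I(x)\nabla_bf_I(x) =2A^2u^bu_a(\mathsf{RE}-\mathsf{RE}_* )^{\beta}\lim_{y\to x}\nabla_b^{(x)}K(x,y;\lambda),$$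 which is zero for a Gaussian kernel.
   Context: Notation: $\nabla_b=\partial/\partial x_b$, $\nabla_b^{(x)}$ is the derivative in the variable $x$, $\Delta=\nabla_b\nabla^b$, repeated indices are summed, $\|\cdot\|$ is the Euclidean norm, $\mathbb{E}$ is expectation, and $L$ is the length scale of the domain, $\mathrm{vol}(G)\sim L^3$. $\mathscr{U}_a(x)$ is $\mathscr{U}_a(x,t)$, which does not depend on $t$. The Gaussian kernel is $K(x,y;\lambda)=\exp(-\|x-y\|^2/\lambda^2)$. Gaussian random field and Karhunen-Loeve expansion: $\mathscr{T}$ is a centred Gaussian random field on $G$ with $\mathbb{E}[\mathscr{T}(x)]=0$ and $\mathbb{E}[\mathscr{T}(x)\mathscr{T}(y)]=K(x,y;\lambda)$, where $K$ is stationary and isotropic, with correlation length $\lambda$, and regulated ($K(x,x;\lambda)<\infty$). The eigenvalues $Z_I>0$ and real eigenfunctions $f_I$ satisfy $\int_GK(x,y;\lambda)f_I(y)\,dy=Z_If_I(x)$ and $\int_Gf_If_J\,dx=\delta_{IJ}$, with $K(x,y;\lambda)=\sum_IZ_If_I(x)f_I(y)$. The $\xi_I$ are standard Gaussian random variables with $\mathbb{E}[\xi_I]=0$, $\mathbb{E}[\xi_I\xi_J]=\delta_{IJ}$, and $\mathscr{T}=\sum_IZ_I^{1/2}f_I\xi_I$. The $f_I$ are twice differentiable and derivatives of $\mathscr{T}$ are taken term by term.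
   Formalization: In the middle expression the factor Z_I^{1/2} is replaced by Z_I, since with Z_I^{1/2} the first equality fails (e.g. for a Gaussian kernel on a small box); the factor 2 and exponent β are as printed. *)

theory Defs
  imports "HOL-Probability.Probability"
begin

(* The partial derivative along the b-th coordinate axis.  As always with deriv, its value is
   meaningful only where the partial derivative exists. *)
definition pd :: "3 \<Rightarrow> (real^3 \<Rightarrow> real) \<Rightarrow> real^3 \<Rightarrow> real" where
  "pd b f x = deriv (\<lambda>s. f (x + s *\<^sub>R axis b 1)) 0"

definition has_pd_at :: "3 \<Rightarrow> (real^3 \<Rightarrow> real) \<Rightarrow> real^3 \<Rightarrow> bool" where
  "has_pd_at b f x \<longleftrightarrow> (\<lambda>s. f (x + s *\<^sub>R axis b 1)) field_differentiable (at 0)"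

definition laplacian :: "(real^3 \<Rightarrow> real) \<Rightarrow> real^3 \<Rightarrow> real" where
  "laplacian f x = (\<Sum>b\<in>UNIV. pd b (pd b f) x)"

definition twice_differentiable_on :: "(real^3 \<Rightarrow> real) \<Rightarrow> (real^3) set \<Rightarrow> bool" where
  "twice_differentiable_on f S \<longleftrightarrow>
     (\<forall>x\<in>S. f differentiable (at x) \<and> (\<forall>b. pd b f differentiable (at x)))"

(* Component a of  d_t V + (V . grad) V - nu Laplacian V  for a velocity field V x t. *)
definition ns_lhs :: "real \<Rightarrow> (real^3 \<Rightarrow> real \<Rightarrow> real^3) \<Rightarrow> 3 \<Rightarrow> real^3 \<Rightarrow> real \<Rightarrow> real" where
  "ns_lhs \<nu> V a x t =
     deriv (\<lambda>s. V x s $ a) t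
     + (\<Sum>b\<in>UNIV. V x t $ b * pd b (\<lambda>z. V z t $ a) x)
     - \<nu> * laplacian (\<lambda>z. V z t $ a) x"

(* Incompressible Navier-Stokes equations, with the density absorbed in the pressure. *)
definition navier_stokes_on ::
  "(real^3) set \<Rightarrow> real \<Rightarrow> (real^3 \<Rightarrow> real \<Rightarrow> real^3) \<Rightarrow> (real^3 \<Rightarrow> real \<Rightarrow> real) \<Rightarrow> bool" where
  "navier_stokes_on G \<nu> V p \<longleftrightarrow>
     (\<forall>x\<in>G. \<forall>t.
        (\<forall>a. ns_lhs \<nu> V a x t = - pd a (\<lambda>z. p z t) x) \<and>
        (\<Sum>b\<in>UNIV. pd b (\<lambda>z. V z t $ b) x) = 0)"

definition stationary_kernel :: "(real^3 \<Rightarrow> real^3 \<Rightarrow> real) \<Rightarrow> bool" where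
  "stationary_kernel k \<longleftrightarrow> (\<forall>h x y. k (x + h) (y + h) = k x y)"

definition isotropic_kernel :: "(real^3 \<Rightarrow> real^3 \<Rightarrow> real) \<Rightarrow> bool" where
  "isotropic_kernel k \<longleftrightarrow> (\<forall>R. orthogonal_transformation R \<longrightarrow> (\<forall>x y. k (R x) (R y) = k x y))"

definition gaussian_kernel :: "real^3 \<Rightarrow> real^3 \<Rightarrow> real \<Rightarrow> real" where
  "gaussian_kernel x y l = exp (- (norm (x - y))\<^sup>2 / l\<^sup>2)"

(* Degenerate (almost surely constant) variables count as Gaussian. *)
definition gaussian_rv :: "'w measure \<Rightarrow> ('w \<Rightarrow> real) \<Rightarrow> bool" where
  "gaussian_rv M X \<longleftrightarrow> X \<in> borel_measurable M \<and>
     ((\<exists>\<mu> \<sigma>. \<sigma> > 0 \<and> distributed M lborel X (normal_density \<mu> \<sigma>)) \<or> (\<exists>\<mu>. AE \<omega> in M. X \<omega> = \<mu>))"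

(* Joint Gaussianity of the finite-dimensional marginals, through their linear combinations. *)
definition gaussian_field :: "'w measure \<Rightarrow> 'x set \<Rightarrow> ('w \<Rightarrow> 'x \<Rightarrow> real) \<Rightarrow> bool" where
  "gaussian_field M G T \<longleftrightarrow>
     (\<forall>F c. finite F \<and> F \<subseteq> G \<longrightarrow> gaussian_rv M (\<lambda>\<omega>. \<Sum>x\<in>F. c x * T \<omega> x))"

definition centred_gaussian_field_with_covariance ::
  "'w measure \<Rightarrow> 'x set \<Rightarrow> ('w \<Rightarrow> 'x \<Rightarrow> real) \<Rightarrow> ('x \<Rightarrow> 'x \<Rightarrow> real) \<Rightarrow> bool" where
  "centred_gaussian_field_with_covariance M G T k \<longleftrightarrow>
     gaussian_field M G T \<and>
     (\<forall>x\<in>G. (\<integral>\<omega>. T \<omega> x \<partial>M) = 0) \<and>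
     (\<forall>x\<in>G. \<forall>y\<in>G. (\<integral>\<omega>. T \<omega> x * T \<omega> y \<partial>M) = k x y)"

(* The eigenpairs of the integral operator with kernel k, with the expansion of k. *)
definition kernel_eigenexpansion ::
  "(real^3) set \<Rightarrow> (real^3 \<Rightarrow> real^3 \<Rightarrow> real) \<Rightarrow> (nat \<Rightarrow> real) \<Rightarrow> (nat \<Rightarrow> real^3 \<Rightarrow> real) \<Rightarrow> bool" where
  "kernel_eigenexpansion G k Z f \<longleftrightarrow>
     (\<forall>I. Z I > 0) \<and>
     (\<forall>I. \<forall>x\<in>G. set_integrable lborel G (\<lambda>y. k x y * f I y) \<and>
        (LINT y:G|lborel. k x y * f I y) = Z I * f I x) \<and>
     (\<forall>I J. set_integrable lborel G (\<lambda>x. f I x * f J x) \<and>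
        (LINT x:G|lborel. f I x * f J x) = (if I = J then 1 else 0)) \<and>
     (\<forall>x\<in>G. \<forall>y\<in>G. (\<lambda>I. Z I * f I x * f I y) sums k x y)"

definition standard_gaussian_family :: "'w measure \<Rightarrow> (nat \<Rightarrow> 'w \<Rightarrow> real) \<Rightarrow> bool" where
  "standard_gaussian_family M \<xi> \<longleftrightarrow>
     (\<forall>I. distributed M lborel (\<xi> I) std_normal_density) \<and>
     (\<forall>I. (\<integral>\<omega>. \<xi> I \<omega> \<partial>M) = 0) \<and>
     (\<forall>I J. (\<integral>\<omega>. \<xi> I \<omega> * \<xi> J \<omega> \<partial>M) = (if I = J then 1 else 0))"

(* X is the sum of the series of the random variables Y I in L^2(M), the mode of convergence of a
   Karhunen-Loeve series. *)
definition mean_square_sums ::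
  "'w measure \<Rightarrow> (nat \<Rightarrow> 'w \<Rightarrow> real) \<Rightarrow> ('w \<Rightarrow> real) \<Rightarrow> bool" where
  "mean_square_sums M Y X \<longleftrightarrow>
     X \<in> borel_measurable M \<and>
     (\<forall>n. integrable M (\<lambda>\<omega>. (X \<omega> - (\<Sum>I<n. Y I \<omega>))\<^sup>2)) \<and>
     (\<lambda>n. \<integral>\<omega>. (X \<omega> - (\<Sum>I<n. Y I \<omega>))\<^sup>2 \<partial>M) \<longlonglongrightarrow> 0"

(* The Karhunen-Loeve expansion of T.  The derivatives on the left of each series are those of
   the sample paths; that the series sum to them is term-by-term differentiability. *)
definition karhunen_loeve ::
  "'w measure \<Rightarrow> (real^3) set \<Rightarrow> ('w \<Rightarrow> real^3 \<Rightarrow> real) \<Rightarrow>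
   (nat \<Rightarrow> real) \<Rightarrow> (nat \<Rightarrow> real^3 \<Rightarrow> real) \<Rightarrow> (nat \<Rightarrow> 'w \<Rightarrow> real) \<Rightarrow> bool" where
  "karhunen_loeve M G T Z f \<xi> \<longleftrightarrow>
     (\<forall>\<omega>\<in>space M. twice_differentiable_on (T \<omega>) G) \<and>
     (\<forall>x\<in>G.
        mean_square_sums M (\<lambda>I \<omega>. sqrt (Z I) * f I x * \<xi> I \<omega>) (\<lambda>\<omega>. T \<omega> x) \<and>
        (\<forall>b. mean_square_sums M (\<lambda>I \<omega>. sqrt (Z I) * pd b (f I) x * \<xi> I \<omega>)
                (\<lambda>\<omega>. pd b (T \<omega>) x)) \<and>
        (\<forall>b. mean_square_sums M (\<lambda>I \<omega>. sqrt (Z I) * pd b (pd b (f I)) x * \<xi> I \<omega>)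
                (\<lambda>\<omega>. pd b (pd b (T \<omega>)) x)))"

(* The constant flow u mixed with the random field T; it does not depend on the time. *)
definition turbulent_flow ::
  "real^3 \<Rightarrow> real \<Rightarrow> real \<Rightarrow> real \<Rightarrow> real \<Rightarrow> ('w \<Rightarrow> real^3 \<Rightarrow> real) \<Rightarrow> 'w \<Rightarrow> real^3 \<Rightarrow> real \<Rightarrow> real^3" where
  "turbulent_flow u A RE RE\<^sub>c \<beta> T \<omega> x t = u + (A * (RE - RE\<^sub>c) powr \<beta> * T \<omega> x) *\<^sub>R u"

end

(* A centred Gaussian variable satisfies E[exp (-X^2)] = 1 / sqrt (1 + 2 E[X^2]), so a sequence of
   them that tends to 0 pointwise also tends to 0 in mean square.  Applied to increments and
   difference quotients of T, this makes the sample-path derivatives mean-square derivatives;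
   hence E[d_b T(x) T(y)] = d_b K(x,y), continuously in y.  At y = x this vanishes, because
   K(x+h,x) is even in h.  By the mean-square convergence of the Karhunen-Loeve series, E[d_b T]
   and E[d_b d_b T] vanish as well, and sum_I Z_I f_I(x) d_b f_I(x) = E[T(x) d_b T(x)] = 0.
   All the expressions compared in the theorem are therefore 0, which is why the different powers
   of RE - RE_c and the different factors 1 and 2 in front of them agree. *)

theory Submission
  imports Defs
begin

section \<open>Partial derivatives and the Navier-Stokes expression of the mixed flow\<close>

lemma has_real_derivative_pd:
  assumes "f differentiable (at x)"
  shows "((\<lambda>s. f (x + s *\<^sub>R axis b 1)) has_real_derivative pd b f x) (at 0)"
proof -
  have "f differentiable (at (x + 0 *\<^sub>R axis b 1))"
    using assms by simp
  then have "(f \<circ> (\<lambda>s::real. x + s *\<^sub>R axis b 1)) differentiable (at 0)"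
    by (intro differentiable_chain_at) simp_all
  then have "(\<lambda>s. f (x + s *\<^sub>R axis b 1)) differentiable (at 0)"
    by (simp add: o_def)
  then show ?thesis
    unfolding pd_def by (simp add: DERIV_deriv_iff_real_differentiable)
qed

lemma pd_const [simp]: "pd b (\<lambda>z. c) = (\<lambda>x. 0)"
  by (simp add: pd_def fun_eq_iff)

lemma pd_affine:
  assumes "f differentiable (at x)"
  shows "pd b (\<lambda>z. a + c * f z) x = c * pd b f x"
  using DERIV_imp_deriv[OF DERIV_add[OF DERIV_const[of a]
        DERIV_cmult[OF has_real_derivative_pd[OF assms, of b], of c]]]
  by (simp add: pd_def)

lemma open_axis_line:
  fixes G :: "(real^3) set"
  assumes "open G"
  shows "open {s::real. x + s *\<^sub>R axis b 1 \<in> G}"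
proof -
  have "continuous_on UNIV (\<lambda>s::real. x + s *\<^sub>R axis b 1)"
    by (intro continuous_intros)
  then show ?thesis
    using open_vimage[OF assms] by (simp add: vimage_def)
qed

text \<open>Formulas for first partial derivatives are available on \<open>G\<close> only. Openness
  keeps the axis line through \<open>x\<close> inside \<open>G\<close> for small parameters, so such
  a formula may be substituted under a second \<open>pd\<close>.\<close>

lemma pd_cong_open:
  assumes "open G" "x \<in> G" "\<And>z. z \<in> G \<Longrightarrow> f z = g z"
  shows "pd b f x = pd b g x"
  unfolding pd_def
proof (rule deriv_cong_ev)
  have "0 \<in> {s::real. x + s *\<^sub>R axis b 1 \<in> G}"
    using assms by simp
  then have "\<forall>\<^sub>F s in nhds 0. s \<in> {s::real. x + s *\<^sub>R axis b 1 \<in> G}"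
    using open_axis_line[OF assms(1)] eventually_nhds by blast
  then show "\<forall>\<^sub>F s in nhds 0. f (x + s *\<^sub>R axis b 1) = g (x + s *\<^sub>R axis b 1)"
    by eventually_elim (simp add: assms(3))
qed simp

lemma laplacian_affine:
  assumes "open G" "twice_differentiable_on f G" "x \<in> G"
  shows "laplacian (\<lambda>z. a + c * f z) x = c * laplacian f x"
proof -
  have "pd b (pd b (\<lambda>z. a + c * f z)) x = c * pd b (pd b f) x" for b
  proof -
    have "pd b (pd b (\<lambda>z. a + c * f z)) x = pd b (\<lambda>z. 0 + c * pd b f z) x"
      using assms by (intro pd_cong_open) (auto simp: pd_affine twice_differentiable_on_def)
    also have "\<dots> = c * pd b (pd b f) x"
      using assms by (intro pd_affine) (auto simp: twice_differentiable_on_def)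
    finally show ?thesis .
  qed
  then show ?thesis
    by (simp add: laplacian_def sum_distrib_left)
qed

text \<open>The flow has components \<open>u $ a * (1 + c * T)\<close> and is steady, so the time
  derivative drops out. The advection term splits into a part linear in the gradient of
  \<open>T\<close> and a quadratic part carrying \<open>c\<close> squared; only the quadratic part
  needs a covariance when the mean is taken.\<close>

lemma ns_lhs_turbulent_flow:
  fixes A RE RE\<^sub>c \<beta> :: real
  assumes "open G" "twice_differentiable_on (T \<omega>) G" "x \<in> G"
  defines "c \<equiv> A * (RE - RE\<^sub>c) powr \<beta>"
  shows "ns_lhs \<nu> (turbulent_flow u A RE RE\<^sub>c \<beta> T \<omega>) a x t =
    (\<Sum>b\<in>UNIV. c * u $ a * u $ b * pd b (T \<omega>) x + c\<^sup>2 * u $ a * u $ b * (T \<omega> x * pd b (T \<omega>) x))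
      - \<nu> * c * u $ a * (\<Sum>b\<in>UNIV. pd b (pd b (T \<omega>)) x)"
proof -
  have flow: "turbulent_flow u A RE RE\<^sub>c \<beta> T \<omega> z s $ d = u $ d + (c * u $ d) * T \<omega> z" for z s d
    by (simp add: turbulent_flow_def c_def)
  have "pd b (\<lambda>z. u $ a + (c * u $ a) * T \<omega> z) x = c * u $ a * pd b (T \<omega>) x" for b
    using assms by (intro pd_affine) (auto simp: twice_differentiable_on_def)
  then show ?thesis
    unfolding ns_lhs_def flow laplacian_affine[OF assms(1-3)]
    by (simp add: laplacian_def power2_eq_square algebra_simps)
qed

section \<open>Square-integrable random variables and mean-square limits\<close>

definition square_integrable :: "'w measure \<Rightarrow> ('w \<Rightarrow> real) \<Rightarrow> bool" where
  "square_integrable M X \<longleftrightarrow> X \<in> borel_measurable M \<and> integrable M (\<lambda>\<omega>. (X \<omega>)\<^sup>2)"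

lemma square_integrable_cmult:
  "square_integrable M X \<Longrightarrow> square_integrable M (\<lambda>\<omega>. c * X \<omega>)"
  by (auto simp: square_integrable_def power_mult_distrib)

lemma square_integrable_prod:
  assumes "square_integrable M X" "square_integrable M Y"
  shows "integrable M (\<lambda>\<omega>. X \<omega> * Y \<omega>)"
proof (rule Bochner_Integration.integrable_bound)
  show "integrable M (\<lambda>\<omega>. (X \<omega>)\<^sup>2 + (Y \<omega>)\<^sup>2)"
    and "(\<lambda>\<omega>. X \<omega> * Y \<omega>) \<in> borel_measurable M"
    using assms by (auto simp: square_integrable_def)
  have "\<bar>x * y\<bar> \<le> x\<^sup>2 + y\<^sup>2" for x y :: real
  proof -
    have "2 * \<bar>x * y\<bar> \<le> x\<^sup>2 + y\<^sup>2"
      using sum_squares_bound[of "\<bar>x\<bar>" "\<bar>y\<bar>"] by (simp add: abs_mult mult.assoc)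
    then show ?thesis
      by linarith
  qed
  then show "AE \<omega> in M. norm (X \<omega> * Y \<omega>) \<le> norm ((X \<omega>)\<^sup>2 + (Y \<omega>)\<^sup>2)"
    by simp
qed

lemma square_integrable_add:
  assumes "square_integrable M X" "square_integrable M Y"
  shows "square_integrable M (\<lambda>\<omega>. X \<omega> + Y \<omega>)"
proof -
  have "integrable M (\<lambda>\<omega>. (X \<omega>)\<^sup>2 + (Y \<omega>)\<^sup>2 + 2 * (X \<omega> * Y \<omega>))"
    using assms square_integrable_prod[OF assms] by (auto simp: square_integrable_def)
  then show ?thesis
    using assms by (auto simp: square_integrable_def power2_sum mult.assoc)
qed

lemma square_integrable_diff:
  assumes "square_integrable M X" "square_integrable M Y"
  shows "square_integrable M (\<lambda>\<omega>. X \<omega> - Y \<omega>)"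
  using square_integrable_add[OF assms(1) square_integrable_cmult[OF assms(2), of "-1"]] by simp

lemma square_integrable_sum:
  "(\<And>i. i \<in> S \<Longrightarrow> square_integrable M (X i)) \<Longrightarrow> square_integrable M (\<lambda>\<omega>. \<Sum>i\<in>S. X i \<omega>)"
proof (induction S rule: infinite_finite_induct)
  case (insert i S)
  then show ?case by (simp add: square_integrable_add)
qed (simp_all add: square_integrable_def)

text \<open>The second moment of \<open>X + s * Y\<close> is a nonnegative quadratic in
  \<open>s\<close>; evaluating it at a suitable \<open>s\<close> gives the inequality.\<close>

lemma integral_Cauchy_Schwarz:
  assumes X: "square_integrable M X" and Y: "square_integrable M Y"
  shows "\<bar>\<integral>\<omega>. X \<omega> * Y \<omega> \<partial>M\<bar> \<le> sqrt (\<integral>\<omega>. (X \<omega>)\<^sup>2 \<partial>M) * sqrt (\<integral>\<omega>. (Y \<omega>)\<^sup>2 \<partial>M)"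
proof -
  define p where "p = (\<integral>\<omega>. (X \<omega>)\<^sup>2 \<partial>M)"
  define q where "q = (\<integral>\<omega>. X \<omega> * Y \<omega> \<partial>M)"
  define r where "r = (\<integral>\<omega>. (Y \<omega>)\<^sup>2 \<partial>M)"
  have quad: "0 \<le> p + 2 * q * s + r * s\<^sup>2" for s
  proof -
    have "0 \<le> (\<integral>\<omega>. (X \<omega> + s * Y \<omega>)\<^sup>2 \<partial>M)"
      by simp
    also have "\<dots> = (\<integral>\<omega>. (X \<omega>)\<^sup>2 + (2 * s) * (X \<omega> * Y \<omega>) + s\<^sup>2 * (Y \<omega>)\<^sup>2 \<partial>M)"
      by (intro Bochner_Integration.integral_cong) (auto simp: power2_eq_square algebra_simps)
    also have "\<dots> = p + 2 * q * s + r * s\<^sup>2"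
      using X Y square_integrable_prod[OF X Y] by (simp add: square_integrable_def p_def q_def r_def)
    finally show ?thesis .
  qed
  have r: "0 \<le> r"
    by (simp add: r_def)
  have "q\<^sup>2 \<le> p * r"
  proof (cases "r = 0")
    case True
    have "q = 0"
    proof (rule ccontr)
      assume "q \<noteq> 0"
      then show False
        \<comment> \<open>With \<open>r = 0\<close> the quadratic is affine in \<open>s\<close>, and
          this choice of \<open>s\<close> gives it the value -1.\<close>
        using quad[of "- (p + 1) / (2 * q)"] True by simp
    qed
    then show ?thesis using True by simp
  next
    case False
    then show ?thesis
      \<comment> \<open>This \<open>s\<close> is the minimiser, where the value is
        \<open>p - q^2 / r\<close>.\<close>
      using quad[of "- q / r"] r by (simp add: power2_eq_square field_simps)
  qed
  then have "sqrt (q\<^sup>2) \<le> sqrt (p * r)"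
    by (rule real_sqrt_le_mono)
  then show ?thesis
    by (simp add: p_def q_def r_def real_sqrt_mult)
qed

text \<open>Square integrability of the terms and of the limit is built in because the integral of a
  non-integrable function is 0 by convention, so that the last conjunct alone would not express
  convergence.\<close>

definition mean_square_lim :: "'w measure \<Rightarrow> (nat \<Rightarrow> 'w \<Rightarrow> real) \<Rightarrow> ('w \<Rightarrow> real) \<Rightarrow> bool" where
  "mean_square_lim M X Y \<longleftrightarrow>
     (\<forall>n. square_integrable M (X n)) \<and> square_integrable M Y \<and>
     (\<lambda>n. \<integral>\<omega>. (X n \<omega> - Y \<omega>)\<^sup>2 \<partial>M) \<longlonglongrightarrow> 0"

lemma mean_square_lim_const:
  "square_integrable M X \<Longrightarrow> mean_square_lim M (\<lambda>n. X) X"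
  by (simp add: mean_square_lim_def)

text \<open>Continuity of the inner product of L^2: \<open>X W - Y V\<close> is expanded around
  \<open>Y\<close> and \<open>V\<close>, and Cauchy-Schwarz bounds each of the three resulting
  terms. With a constant second factor this also lets means pass to the limit.\<close>

lemma mean_square_lim_prod:
  assumes X: "mean_square_lim M X Y" and W: "mean_square_lim M W V"
  shows "(\<lambda>n. \<integral>\<omega>. X n \<omega> * W n \<omega> \<partial>M) \<longlonglongrightarrow> (\<integral>\<omega>. Y \<omega> * V \<omega> \<partial>M)"
proof -
  define d where "d n = sqrt (\<integral>\<omega>. (X n \<omega> - Y \<omega>)\<^sup>2 \<partial>M)" for n
  define e where "e n = sqrt (\<integral>\<omega>. (W n \<omega> - V \<omega>)\<^sup>2 \<partial>M)" for n
  define y where "y = sqrt (\<integral>\<omega>. (Y \<omega>)\<^sup>2 \<partial>M)"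
  define v where "v = sqrt (\<integral>\<omega>. (V \<omega>)\<^sup>2 \<partial>M)"
  note sq = X[unfolded mean_square_lim_def] W[unfolded mean_square_lim_def]
  have lim: "d \<longlonglongrightarrow> 0" "e \<longlonglongrightarrow> 0"
    using sq tendsto_real_sqrt[of _ 0] unfolding d_def e_def by fastforce+
  have bound: "\<bar>(\<integral>\<omega>. X n \<omega> * W n \<omega> \<partial>M) - (\<integral>\<omega>. Y \<omega> * V \<omega> \<partial>M)\<bar>
      \<le> d n * e n + y * e n + d n * v" for n
  proof -
    have sX: "square_integrable M (\<lambda>\<omega>. X n \<omega> - Y \<omega>)" and sW: "square_integrable M (\<lambda>\<omega>. W n \<omega> - V \<omega>)"
      and sY: "square_integrable M Y" and sV: "square_integrable M V"
      using sq by (auto intro: square_integrable_diff)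
    note int = square_integrable_prod[OF sX sW] square_integrable_prod[OF sY sW]
      square_integrable_prod[OF sX sV] square_integrable_prod[OF sY sV]
    have "(\<integral>\<omega>. X n \<omega> * W n \<omega> \<partial>M) = (\<integral>\<omega>. (X n \<omega> - Y \<omega>) * (W n \<omega> - V \<omega>)
        + Y \<omega> * (W n \<omega> - V \<omega>) + (X n \<omega> - Y \<omega>) * V \<omega> + Y \<omega> * V \<omega> \<partial>M)"
      by (intro Bochner_Integration.integral_cong) (auto simp: algebra_simps)
    also have "\<dots> = (\<integral>\<omega>. (X n \<omega> - Y \<omega>) * (W n \<omega> - V \<omega>) \<partial>M)
        + (\<integral>\<omega>. Y \<omega> * (W n \<omega> - V \<omega>) \<partial>M) + (\<integral>\<omega>. (X n \<omega> - Y \<omega>) * V \<omega> \<partial>M)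
        + (\<integral>\<omega>. Y \<omega> * V \<omega> \<partial>M)"
      by (simp only: Bochner_Integration.integral_add int Bochner_Integration.integrable_add)
    finally show ?thesis
      using integral_Cauchy_Schwarz[OF sX sW] integral_Cauchy_Schwarz[OF sY sW]
        integral_Cauchy_Schwarz[OF sX sV]
      unfolding d_def e_def y_def v_def by linarith
  qed
  have "(\<lambda>n. d n * e n + y * e n + d n * v) \<longlonglongrightarrow> 0 * 0 + y * 0 + 0 * v"
    by (intro tendsto_add tendsto_mult tendsto_const lim)
  then have null: "(\<lambda>n. d n * e n + y * e n + d n * v) \<longlonglongrightarrow> 0"
    by simp
  have "(\<lambda>n. (\<integral>\<omega>. X n \<omega> * W n \<omega> \<partial>M) - (\<integral>\<omega>. Y \<omega> * V \<omega> \<partial>M)) \<longlonglongrightarrow> 0"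
  proof (rule Lim_null_comparison[OF _ null])
    show "\<forall>\<^sub>F n in sequentially. norm ((\<integral>\<omega>. X n \<omega> * W n \<omega> \<partial>M) - (\<integral>\<omega>. Y \<omega> * V \<omega> \<partial>M))
        \<le> d n * e n + y * e n + d n * v"
      unfolding real_norm_def by (rule always_eventually[OF allI]) (rule bound)
  qed
  then show ?thesis
    by (rule LIM_zero_cancel)
qed

section \<open>From pointwise to mean-square convergence for centred Gaussian variables\<close>

context prob_space
begin

lemma square_integrable_const: "square_integrable M (\<lambda>\<omega>. c)"
  by (simp add: square_integrable_def)

lemma square_integrable_integrable: "square_integrable M X \<Longrightarrow> integrable M X"
  using square_integrable_prod[OF _ square_integrable_const[of 1]] by simp

lemma mean_square_lim_expectation:
  assumes "mean_square_lim M X Y"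
  shows "(\<lambda>n. expectation (X n)) \<longlonglongrightarrow> expectation Y"
  using mean_square_lim_prod[OF assms mean_square_lim_const[OF square_integrable_const[of 1]]]
  by simp

lemma square_integrable_std_normal:
  assumes "distributed M lborel X std_normal_density"
  shows "square_integrable M X"
  using distributed_integrable[OF assms, of "\<lambda>x. x\<^sup>2"] integrable_std_normal_moment[of 2]
    distributed_measurable[OF assms]
  by (simp add: square_integrable_def)

definition centred_gaussian :: "('a \<Rightarrow> real) \<Rightarrow> bool" where
  "centred_gaussian X \<longleftrightarrow> gaussian_rv M X \<and> square_integrable M X \<and> expectation X = 0"

text \<open>Multiplying a centred normal density by \<open>exp (- x^2)\<close> gives a multiple of a
  narrower centred normal density. The point is that the mean of a bounded function of
  \<open>X\<close> determines the variance.\<close>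

lemma centred_gaussian_expectation_exp:
  assumes "centred_gaussian X"
  shows "expectation (\<lambda>\<omega>. exp (- (X \<omega>)\<^sup>2)) = 1 / sqrt (1 + 2 * expectation (\<lambda>\<omega>. (X \<omega>)\<^sup>2))"
proof -
  have mean: "expectation X = 0" and meas [measurable]: "X \<in> borel_measurable M"
    using assms by (auto simp: centred_gaussian_def gaussian_rv_def)
  consider \<mu> \<sigma> where "\<sigma> > 0" "distributed M lborel X (normal_density \<mu> \<sigma>)"
    | \<mu> where "AE \<omega> in M. X \<omega> = \<mu>"
    using assms by (auto simp: centred_gaussian_def gaussian_rv_def)
  then show ?thesis
  proof cases
    case 1
    have "\<mu> = 0"
      using normal_distributed_expectation[OF 1] mean by simp
    note D = 1(2)[unfolded this]
    have "variance X = \<sigma>\<^sup>2"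
      using normal_distributed_variance[OF 1(1) D] .
    then have var: "expectation (\<lambda>\<omega>. (X \<omega>)\<^sup>2) = \<sigma>\<^sup>2"
      by (simp add: mean)
    \<comment> \<open>Chosen so that \<open>1 / \<sigma>^2 + 2 = (q / \<sigma>)^2\<close>: the
      deviation shrinks to \<open>\<sigma> / q\<close>, and renormalising the density leaves the
      factor \<open>1 / q\<close>.\<close>
    define q where "q = sqrt (1 + 2 * \<sigma>\<^sup>2)"
    have q: "q > 0" "q\<^sup>2 = 1 + 2 * \<sigma>\<^sup>2"
      by (auto simp: q_def add_pos_nonneg)
    have "normal_density 0 \<sigma> x * exp (- x\<^sup>2) = (1 / q) * normal_density 0 (\<sigma> / q) x" for x
    proof -
      have e: "- x\<^sup>2 / (2 * \<sigma>\<^sup>2) - x\<^sup>2 = - x\<^sup>2 / (2 * (\<sigma> / q)\<^sup>2)"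
        using 1(1) q by (simp add: power_divide divide_simps) (simp add: algebra_simps)
      have s: "sqrt (2 * pi * (\<sigma> / q)\<^sup>2) = sqrt (2 * pi * \<sigma>\<^sup>2) / q"
        using q(1) by (simp add: power_divide real_sqrt_divide)
      have "normal_density 0 \<sigma> x * exp (- x\<^sup>2) = 1 / sqrt (2 * pi * \<sigma>\<^sup>2) * exp (- x\<^sup>2 / (2 * \<sigma>\<^sup>2) - x\<^sup>2)"
        by (simp add: normal_density_def exp_add[symmetric])
      then show ?thesis
        using q(1) by (simp only: e) (simp add: normal_density_def s)
    qed
    then have "(\<integral>x. normal_density 0 \<sigma> x * exp (- x\<^sup>2) \<partial>lborel) = 1 / q"
      using 1(1) q(1) by simp
    then show ?thesis
      using distributed_integral[OF D, of "\<lambda>x. exp (- x\<^sup>2)"] by (simp add: var q_def)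
  next
    \<comment> \<open>In the degenerate case the zero mean forces the constant to be 0, and both
      sides equal 1.\<close>
    case 2
    have "expectation X = \<mu>"
      using integral_cong_AE[of X M "\<lambda>_. \<mu>"] 2 prob_space by simp
    then have AE: "AE \<omega> in M. X \<omega> = 0"
      using 2 mean by simp
    have "expectation (\<lambda>\<omega>. exp (- (X \<omega>)\<^sup>2)) = expectation (\<lambda>_. 1)"
      using AE by (intro integral_cong_AE) auto
    moreover have "expectation (\<lambda>\<omega>. (X \<omega>)\<^sup>2) = expectation (\<lambda>_. 0)"
      using AE by (intro integral_cong_AE) auto
    ultimately show ?thesis
      by (simp add: prob_space)
  qed
qed

text \<open>The squares have no evident integrable majorant, but \<open>exp (- X^2)\<close> is at
  most 1, so dominated convergence applies to it, and the variances are functions of the resulting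
  means.\<close>

lemma centred_gaussian_tendsto_0:
  fixes X :: "nat \<Rightarrow> 'a \<Rightarrow> real"
  assumes X: "\<And>n. centred_gaussian (X n)"
    and lim: "\<And>\<omega>. \<omega> \<in> space M \<Longrightarrow> (\<lambda>n. X n \<omega>) \<longlonglongrightarrow> 0"
  shows "(\<lambda>n. expectation (\<lambda>\<omega>. (X n \<omega>)\<^sup>2)) \<longlonglongrightarrow> 0"
proof -
  define e where "e n = expectation (\<lambda>\<omega>. exp (- (X n \<omega>)\<^sup>2))" for n
  define v where "v n = expectation (\<lambda>\<omega>. (X n \<omega>)\<^sup>2)" for n
  have [measurable]: "X n \<in> borel_measurable M" for n
    using X[of n] by (auto simp: centred_gaussian_def gaussian_rv_def)
  have "e \<longlonglongrightarrow> expectation (\<lambda>_. 1)"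
    unfolding e_def
  proof (rule integral_dominated_convergence[where w = "\<lambda>_. 1"])
    have "(\<lambda>n. exp (- (X n \<omega>)\<^sup>2)) \<longlonglongrightarrow> exp (- 0\<^sup>2)" if "\<omega> \<in> space M" for \<omega>
      by (intro tendsto_intros lim that)
    then show "AE \<omega> in M. (\<lambda>n. exp (- (X n \<omega>)\<^sup>2)) \<longlonglongrightarrow> 1"
      by simp
  qed auto
  then have "e \<longlonglongrightarrow> 1"
    by (simp add: prob_space)
  \<comment> \<open>This solves \<open>e = 1 / sqrt (1 + 2 * v)\<close> for
    \<open>v\<close>.\<close>
  then have "(\<lambda>n. ((1 / e n)\<^sup>2 - 1) / 2) \<longlonglongrightarrow> ((1 / 1)\<^sup>2 - 1) / 2"
    by (intro tendsto_intros) auto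
  moreover have "((1 / e n)\<^sup>2 - 1) / 2 = v n" for n
    using centred_gaussian_expectation_exp[OF X[of n]] by (simp add: e_def v_def add_nonneg_nonneg)
  ultimately show ?thesis
    by (simp add: v_def)
qed

text \<open>Gaussianity is asked of the increments, so that it need not be established for the limit
  \<open>Y\<close>, which will be a sample-path derivative. The increments tend to 0, hence the
  sequence is Cauchy in mean square, and Fatou's lemma identifies its limit as
  \<open>Y\<close>.\<close>

lemma centred_gaussian_mean_square_lim:
  fixes X :: "nat \<Rightarrow> 'a \<Rightarrow> real"
  assumes X: "\<And>n. square_integrable M (X n)"
    and Y: "square_integrable M Y"
    and gauss: "\<And>n m. centred_gaussian (\<lambda>\<omega>. X n \<omega> - X m \<omega>)"
    and lim: "\<And>\<omega>. \<omega> \<in> space M \<Longrightarrow> (\<lambda>n. X n \<omega>) \<longlonglongrightarrow> Y \<omega>"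
  shows "mean_square_lim M X Y"
proof -
  have cauchy: "\<exists>N. \<forall>n\<ge>N. \<forall>m\<ge>N. expectation (\<lambda>\<omega>. (X n \<omega> - X m \<omega>)\<^sup>2) < \<epsilon>" if "\<epsilon> > 0" for \<epsilon>
  proof (rule ccontr)
    assume "\<not> ?thesis"
    \<comment> \<open>A failure of the Cauchy property yields two index sequences that both tend to
      infinity, along which the increments tend to 0 pointwise but not in mean square.\<close>
    then obtain i j where ij: "i N \<ge> N" "j N \<ge> N"
      "\<not> expectation (\<lambda>\<omega>. (X (i N) \<omega> - X (j N) \<omega>)\<^sup>2) < \<epsilon>" for N :: nat
      by metis
    have sub: "filterlim i at_top sequentially" "filterlim j at_top sequentially"
      using ij(1,2) by (auto intro: filterlim_at_top_mono[OF filterlim_ident] simp: eventually_sequentially)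
    have "(\<lambda>N. X (i N) \<omega> - X (j N) \<omega>) \<longlonglongrightarrow> 0" if "\<omega> \<in> space M" for \<omega>
      using tendsto_diff[OF filterlim_compose[OF lim[OF that] sub(1)]
          filterlim_compose[OF lim[OF that] sub(2)]] by simp
    then have "(\<lambda>N. expectation (\<lambda>\<omega>. (X (i N) \<omega> - X (j N) \<omega>)\<^sup>2)) \<longlonglongrightarrow> 0"
      using gauss by (intro centred_gaussian_tendsto_0) auto
    then have "\<forall>\<^sub>F N in sequentially. expectation (\<lambda>\<omega>. (X (i N) \<omega> - X (j N) \<omega>)\<^sup>2) < \<epsilon>"
      using that by (rule order_tendstoD)
    then show False
      using ij(3) by (auto simp: eventually_sequentially)
  qed
  have [measurable]: "Y \<in> borel_measurable M" "X n \<in> borel_measurable M" for n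
    using X Y by (auto simp: square_integrable_def)
  have "(\<lambda>n. expectation (\<lambda>\<omega>. (X n \<omega> - Y \<omega>)\<^sup>2)) \<longlonglongrightarrow> 0"
  proof (rule LIMSEQ_I)
    fix r :: real
    assume "0 < r"
    then obtain N where N: "\<And>n m. n \<ge> N \<Longrightarrow> m \<ge> N \<Longrightarrow> expectation (\<lambda>\<omega>. (X n \<omega> - X m \<omega>)\<^sup>2) < r / 2"
      using cauchy[of "r / 2"] by auto
    have "expectation (\<lambda>\<omega>. (X n \<omega> - Y \<omega>)\<^sup>2) \<le> r / 2" if n: "n \<ge> N" for n
    proof -
      have "ennreal (expectation (\<lambda>\<omega>. (X n \<omega> - Y \<omega>)\<^sup>2)) = (\<integral>\<^sup>+\<omega>. ennreal ((X n \<omega> - Y \<omega>)\<^sup>2) \<partial>M)"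
        using square_integrable_diff[OF X Y]
        by (intro nn_integral_eq_integral[symmetric]) (auto simp: square_integrable_def)
      \<comment> \<open>For fixed \<open>n\<close> the integrand is the pointwise limit over
        \<open>m\<close> of the squared increments. Fatou's lemma gives only a weak inequality,
        which is why the Cauchy bound was taken at \<open>r / 2\<close>.\<close>
      also have "\<dots> = (\<integral>\<^sup>+\<omega>. liminf (\<lambda>m. ennreal ((X n \<omega> - X m \<omega>)\<^sup>2)) \<partial>M)"
      proof (rule nn_integral_cong)
        fix \<omega>
        assume "\<omega> \<in> space M"
        then have "(\<lambda>m. ennreal ((X n \<omega> - X m \<omega>)\<^sup>2)) \<longlonglongrightarrow> ennreal ((X n \<omega> - Y \<omega>)\<^sup>2)"
          by (intro tendsto_ennrealI tendsto_intros lim)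
        then show "ennreal ((X n \<omega> - Y \<omega>)\<^sup>2) = liminf (\<lambda>m. ennreal ((X n \<omega> - X m \<omega>)\<^sup>2))"
          by (rule lim_imp_Liminf[OF sequentially_bot, symmetric])
      qed
      also have "\<dots> \<le> liminf (\<lambda>m. \<integral>\<^sup>+\<omega>. ennreal ((X n \<omega> - X m \<omega>)\<^sup>2) \<partial>M)"
        by (rule nn_integral_liminf) measurable
      also have "\<dots> = liminf (\<lambda>m. ennreal (expectation (\<lambda>\<omega>. (X n \<omega> - X m \<omega>)\<^sup>2)))"
        using square_integrable_diff[OF X X]
        by (intro arg_cong[where f = liminf] ext nn_integral_eq_integral)
          (auto simp: square_integrable_def)
      also have "\<dots> \<le> liminf (\<lambda>m. ennreal (r / 2))"
        using N[OF n] by (intro Liminf_mono eventually_sequentiallyI[of N] ennreal_leI less_imp_le)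
      also have "\<dots> = ennreal (r / 2)"
        by (simp add: Liminf_const)
      finally show ?thesis
        using \<open>0 < r\<close> by simp
    qed
    then have "\<forall>n\<ge>N. norm (expectation (\<lambda>\<omega>. (X n \<omega> - Y \<omega>)\<^sup>2) - 0) < r"
      using \<open>0 < r\<close> by fastforce
    then show "\<exists>N. \<forall>n\<ge>N. norm (expectation (\<lambda>\<omega>. (X n \<omega> - Y \<omega>)\<^sup>2) - 0) < r" ..
  qed
  then show ?thesis
    using X Y by (simp add: mean_square_lim_def)
qed

end

section \<open>Linear combinations of field values and Gaussian series\<close>

lemma gaussian_field_comb:
  assumes "gaussian_field M G T" "finite I" "\<And>i. i \<in> I \<Longrightarrow> y i \<in> G"
  shows "gaussian_rv M (\<lambda>\<omega>. \<Sum>i\<in>I. a i * T \<omega> (y i))"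
proof -
  \<comment> \<open>The points \<open>y i\<close> may coincide, whereas
    \<open>gaussian_field\<close> speaks of sums over a set of points; hence the coefficients are
    collected over each fibre of \<open>y\<close>.\<close>
  define c where "c z = (\<Sum>i\<in>{i\<in>I. y i = z}. a i)" for z
  have "(\<Sum>i\<in>I. a i * T \<omega> (y i)) = (\<Sum>z\<in>y ` I. c z * T \<omega> z)" for \<omega>
    using sum.image_gen[OF assms(2), of "\<lambda>i. a i * T \<omega> (y i)" y]
    by (simp add: c_def sum_distrib_right)
  then show ?thesis
    using assms unfolding gaussian_field_def by (simp add: image_subset_iff)
qed

lemma mean_square_sums_lim:
  assumes "mean_square_sums M Y X" "\<And>I. square_integrable M (Y I)"
  shows "mean_square_lim M (\<lambda>n \<omega>. \<Sum>I<n. Y I \<omega>) X"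
proof -
  \<comment> \<open>The empty partial sum turns the integrability clause into square integrability
    of \<open>X\<close> itself.\<close>
  have "integrable M (\<lambda>\<omega>. (X \<omega> - (\<Sum>I<0. Y I \<omega>))\<^sup>2)"
    using assms(1) unfolding mean_square_sums_def by blast
  then have "square_integrable M X"
    using assms(1) by (simp add: square_integrable_def mean_square_sums_def)
  then show ?thesis
    using assms
    by (simp add: mean_square_lim_def mean_square_sums_def square_integrable_sum power2_commute)
qed

context prob_space
begin

lemma standard_gaussian_series_lim:
  assumes "standard_gaussian_family M \<xi>" "mean_square_sums M (\<lambda>I \<omega>. a I * \<xi> I \<omega>) X"
  shows "mean_square_lim M (\<lambda>n \<omega>. \<Sum>I<n. a I * \<xi> I \<omega>) X"
  using assms
  by (intro mean_square_sums_lim square_integrable_cmult square_integrable_std_normal)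
    (auto simp: standard_gaussian_family_def)

text \<open>Every partial sum has mean zero, and means pass to mean-square limits. This handles the
  terms linear in the derivatives of the field.\<close>

lemma expectation_standard_gaussian_series:
  assumes \<xi>: "standard_gaussian_family M \<xi>" and X: "mean_square_sums M (\<lambda>I \<omega>. a I * \<xi> I \<omega>) X"
  shows "expectation X = 0"
proof -
  have "square_integrable M (\<xi> I)" for I
    using \<xi> by (auto simp: standard_gaussian_family_def intro: square_integrable_std_normal)
  then have "expectation (\<lambda>\<omega>. \<Sum>I<n. a I * \<xi> I \<omega>) = 0" for n
    using \<xi> by (simp add: standard_gaussian_family_def square_integrable_integrable)
  then show ?thesis
    using mean_square_lim_expectation[OF standard_gaussian_series_lim[OF \<xi> X]]
    by (simp add: LIMSEQ_const_iff)
qed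

text \<open>Parseval's identity: orthonormality of the \<open>\<xi> I\<close> collapses the double
  sum to its diagonal. Convergence of the coefficient series comes out along with its value.\<close>

lemma sums_expectation_standard_gaussian_series_mult:
  assumes \<xi>: "standard_gaussian_family M \<xi>"
    and X: "mean_square_sums M (\<lambda>I \<omega>. a I * \<xi> I \<omega>) X"
    and Y: "mean_square_sums M (\<lambda>I \<omega>. b I * \<xi> I \<omega>) Y"
  shows "(\<lambda>I. a I * b I) sums expectation (\<lambda>\<omega>. X \<omega> * Y \<omega>)"
proof -
  have sq: "square_integrable M (\<xi> I)" for I
    using \<xi> by (auto simp: standard_gaussian_family_def intro: square_integrable_std_normal)
  have "expectation (\<lambda>\<omega>. (\<Sum>I<n. a I * \<xi> I \<omega>) * (\<Sum>I<n. b I * \<xi> I \<omega>)) = (\<Sum>I<n. a I * b I)" for n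
  proof -
    have "expectation (\<lambda>\<omega>. (\<Sum>I<n. a I * \<xi> I \<omega>) * (\<Sum>I<n. b I * \<xi> I \<omega>))
        = expectation (\<lambda>\<omega>. \<Sum>I<n. \<Sum>J<n. (a I * b J) * (\<xi> I \<omega> * \<xi> J \<omega>))"
      by (simp add: sum_product mult_ac)
    also have "\<dots> = (\<Sum>I<n. \<Sum>J<n. (a I * b J) * (if I = J then 1 else 0))"
      using \<xi> by (simp add: standard_gaussian_family_def square_integrable_prod[OF sq sq])
    also have "\<dots> = (\<Sum>I<n. a I * b I)"
      by (simp add: if_distrib sum.delta cong: if_cong)
    finally show ?thesis .
  qed
  then show ?thesis
    using mean_square_lim_prod[OF standard_gaussian_series_lim[OF \<xi> X]
        standard_gaussian_series_lim[OF \<xi> Y]]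
    by (simp add: sums_def)
qed

end

section \<open>Mean-square calculus of a Gaussian field with differentiable sample paths\<close>

locale differentiable_gaussian_field = prob_space M for M :: "'w measure" +
  fixes G :: "(real^3) set" and T :: "'w \<Rightarrow> real^3 \<Rightarrow> real" and k :: "real^3 \<Rightarrow> real^3 \<Rightarrow> real"
  assumes open_domain: "open G"
    and field: "centred_gaussian_field_with_covariance M G T k"
    and differentiable: "\<And>\<omega> x. \<omega> \<in> space M \<Longrightarrow> x \<in> G \<Longrightarrow> T \<omega> differentiable (at x)"
    and square_integrable_field: "\<And>x. x \<in> G \<Longrightarrow> square_integrable M (\<lambda>\<omega>. T \<omega> x)"
    and square_integrable_pd: "\<And>b x. x \<in> G \<Longrightarrow> square_integrable M (\<lambda>\<omega>. pd b (T \<omega>) x)"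
begin

lemma covariance:
  "x \<in> G \<Longrightarrow> y \<in> G \<Longrightarrow> expectation (\<lambda>\<omega>. T \<omega> x * T \<omega> y) = k x y"
  using field by (simp add: centred_gaussian_field_with_covariance_def)

lemma centred_gaussian_comb:
  assumes "finite I" "\<And>i. i \<in> I \<Longrightarrow> y i \<in> G"
  shows "centred_gaussian (\<lambda>\<omega>. \<Sum>i\<in>I. a i * T \<omega> (y i))"
proof -
  have "gaussian_rv M (\<lambda>\<omega>. \<Sum>i\<in>I. a i * T \<omega> (y i))"
    using field assms by (intro gaussian_field_comb)
      (auto simp: centred_gaussian_field_with_covariance_def)
  moreover have "square_integrable M (\<lambda>\<omega>. \<Sum>i\<in>I. a i * T \<omega> (y i))"
    using assms by (intro square_integrable_sum square_integrable_cmult square_integrable_field)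
  moreover have "expectation (\<lambda>\<omega>. \<Sum>i\<in>I. a i * T \<omega> (y i)) = (\<Sum>i\<in>I. a i * expectation (\<lambda>\<omega>. T \<omega> (y i)))"
    using assms by (simp add: square_integrable_field square_integrable_integrable)
  then have "expectation (\<lambda>\<omega>. \<Sum>i\<in>I. a i * T \<omega> (y i)) = 0"
    using field assms by (simp add: centred_gaussian_field_with_covariance_def)
  ultimately show ?thesis
    by (simp add: centred_gaussian_def)
qed

lemma mean_square_continuous:
  assumes "x \<in> G" "\<And>n. y n \<in> G" "y \<longlonglongrightarrow> x"
  shows "mean_square_lim M (\<lambda>n \<omega>. T \<omega> (y n)) (\<lambda>\<omega>. T \<omega> x)"
proof (rule centred_gaussian_mean_square_lim)
  fix n m
  show "centred_gaussian (\<lambda>\<omega>. T \<omega> (y n) - T \<omega> (y m))"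
  proof -
    \<comment> \<open>The increment is written as a combination indexed by \<open>{..<2}\<close>,
      with points and coefficients looked up in lists.\<close>
    have "[y n, y m] ! i \<in> G" if "i \<in> {..<2}" for i
      using assms(2) that nth_mem[of i "[y n, y m]"] by auto
    then show ?thesis
      using centred_gaussian_comb[of "{..<2::nat}" "(!) [y n, y m]" "(!) [1, -1]"]
      by (simp add: numeral_eq_Suc lessThan_Suc algebra_simps)
  qed
next
  fix \<omega> assume "\<omega> \<in> space M"
  then have "isCont (T \<omega>) x"
    using assms(1) differentiable differentiable_imp_continuous_within by blast
  then show "(\<lambda>n. T \<omega> (y n)) \<longlonglongrightarrow> T \<omega> x"
    using assms(3) by (rule isCont_tendsto_compose)
qed (use assms in \<open>auto intro: square_integrable_field\<close>)

text \<open>A difference of two difference quotients is a linear combination of four field values,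
  with \<open>x\<close> occurring twice, and is therefore centred Gaussian; the pointwise limit then
  upgrades to a mean-square one.\<close>

lemma mean_square_differentiable:
  fixes h :: "nat \<Rightarrow> real"
  assumes "x \<in> G" "\<And>n. x + h n *\<^sub>R axis b 1 \<in> G" "\<And>n. h n \<noteq> 0" "h \<longlonglongrightarrow> 0"
  shows "mean_square_lim M (\<lambda>n \<omega>. (T \<omega> (x + h n *\<^sub>R axis b 1) - T \<omega> x) / h n) (\<lambda>\<omega>. pd b (T \<omega>) x)"
proof (rule centred_gaussian_mean_square_lim)
  fix n
  have "square_integrable M (\<lambda>\<omega>. inverse (h n) * (T \<omega> (x + h n *\<^sub>R axis b 1) - T \<omega> x))"
    using assms by (intro square_integrable_cmult square_integrable_diff square_integrable_field)
  then show "square_integrable M (\<lambda>\<omega>. (T \<omega> (x + h n *\<^sub>R axis b 1) - T \<omega> x) / h n)"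
    by (simp add: divide_inverse mult.commute)
next
  fix n m
  let ?y = "\<lambda>n. x + h n *\<^sub>R axis b 1"
  have "[?y n, x, ?y m, x] ! i \<in> G" if "i \<in> {..<4}" for i
    using assms(1,2) that nth_mem[of i "[?y n, x, ?y m, x]"] by auto
  then show "centred_gaussian (\<lambda>\<omega>. (T \<omega> (?y n) - T \<omega> x) / h n - (T \<omega> (?y m) - T \<omega> x) / h m)"
    using centred_gaussian_comb[of "{..<4::nat}" "(!) [?y n, x, ?y m, x]"
        "(!) [1 / h n, - 1 / h n, - 1 / h m, 1 / h m]"]
    by (simp add: numeral_eq_Suc lessThan_Suc diff_divide_distrib algebra_simps)
next
  fix \<omega> assume "\<omega> \<in> space M"
  then have "((\<lambda>s. T \<omega> (x + s *\<^sub>R axis b 1)) has_real_derivative pd b (T \<omega>) x) (at 0)"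
    using assms(1) by (intro has_real_derivative_pd differentiable)
  then have "((\<lambda>s. (T \<omega> (x + s *\<^sub>R axis b 1) - T \<omega> x) / s) \<longlongrightarrow> pd b (T \<omega>) x) (at 0)"
    by (simp add: DERIV_def)
  then show "(\<lambda>n. (T \<omega> (x + h n *\<^sub>R axis b 1) - T \<omega> x) / h n) \<longlonglongrightarrow> pd b (T \<omega>) x"
    using assms(3,4) by (simp add: tendsto_at_iff_sequentially o_def)
qed (use assms in \<open>auto intro: square_integrable_pd\<close>)

text \<open>The difference quotient of \<open>k\<close> in its first argument is the covariance of
  \<open>T \<omega> y\<close> with the difference quotient of the field, so differentiability of the
  covariance is inherited from the paths.\<close>

lemma covariance_has_derivative:
  assumes x: "x \<in> G" and y: "y \<in> G"
  shows "((\<lambda>s. k (x + s *\<^sub>R axis b 1) y) has_real_derivative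
    expectation (\<lambda>\<omega>. pd b (T \<omega>) x * T \<omega> y)) (at 0)"
proof -
  \<comment> \<open>Restricting to the open set \<open>S\<close> changes no limit at 0 and keeps
    every sequence of increments inside the domain.\<close>
  define S where "S = {s::real. x + s *\<^sub>R axis b 1 \<in> G}"
  have S: "at 0 = at 0 within S"
    using x open_axis_line[OF open_domain] by (intro at_within_open[symmetric]) (auto simp: S_def)
  have "((\<lambda>s. (k (x + s *\<^sub>R axis b 1) y - k x y) / s) \<longlongrightarrow>
      expectation (\<lambda>\<omega>. pd b (T \<omega>) x * T \<omega> y)) (at 0 within S)"
    unfolding tendsto_at_iff_sequentially
  proof (intro allI impI)
    fix h :: "nat \<Rightarrow> real"
    assume h: "\<forall>i. h i \<in> S - {0}" "h \<longlonglongrightarrow> 0"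
    have hG: "x + h n *\<^sub>R axis b 1 \<in> G" for n
      using h by (auto simp: S_def)
    have "mean_square_lim M (\<lambda>n \<omega>. (T \<omega> (x + h n *\<^sub>R axis b 1) - T \<omega> x) / h n) (\<lambda>\<omega>. pd b (T \<omega>) x)"
      using h hG x by (intro mean_square_differentiable) auto
    from mean_square_lim_prod[OF this mean_square_lim_const[OF square_integrable_field[OF y]]]
    have "(\<lambda>n. expectation (\<lambda>\<omega>. (T \<omega> (x + h n *\<^sub>R axis b 1) - T \<omega> x) / h n * T \<omega> y))
      \<longlonglongrightarrow> expectation (\<lambda>\<omega>. pd b (T \<omega>) x * T \<omega> y)" .
    moreover have "expectation (\<lambda>\<omega>. (T \<omega> (x + h n *\<^sub>R axis b 1) - T \<omega> x) / h n * T \<omega> y)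
        = (k (x + h n *\<^sub>R axis b 1) y - k x y) / h n" for n
    proof -
      have "expectation (\<lambda>\<omega>. (T \<omega> (x + h n *\<^sub>R axis b 1) - T \<omega> x) / h n * T \<omega> y)
          = expectation (\<lambda>\<omega>. (T \<omega> (x + h n *\<^sub>R axis b 1) * T \<omega> y - T \<omega> x * T \<omega> y) / h n)"
        by (simp add: algebra_simps)
      also have "\<dots> = (k (x + h n *\<^sub>R axis b 1) y - k x y) / h n"
        using square_integrable_prod[OF square_integrable_field square_integrable_field] x y hG
        by (simp add: covariance)
      finally show ?thesis .
    qed
    ultimately show "((\<lambda>s. (k (x + s *\<^sub>R axis b 1) y - k x y) / s) \<circ> h)
        \<longlonglongrightarrow> expectation (\<lambda>\<omega>. pd b (T \<omega>) x * T \<omega> y)"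
      by (simp only: o_def)
  qed
  then show ?thesis
    by (simp add: DERIV_def flip: S)
qed

lemma has_pd_at_covariance:
  assumes "x \<in> G" "y \<in> G"
  shows "has_pd_at b (\<lambda>z. k z y) x"
  using covariance_has_derivative[OF assms]
  unfolding has_pd_at_def field_differentiable_def by blast

lemma pd_covariance:
  assumes "x \<in> G" "y \<in> G"
  shows "pd b (\<lambda>z. k z y) x = expectation (\<lambda>\<omega>. pd b (T \<omega>) x * T \<omega> y)"
  using DERIV_imp_deriv[OF covariance_has_derivative[OF assms]] by (simp add: pd_def)

text \<open>By \<open>pd_covariance\<close> the derivative is a covariance with
  \<open>T \<omega> y\<close>, and the field is mean-square continuous in \<open>y\<close>.\<close>

lemma pd_covariance_tendsto:
  assumes x: "x \<in> G"
  shows "((\<lambda>y. pd b (\<lambda>z. k z y) x) \<longlongrightarrow> expectation (\<lambda>\<omega>. pd b (T \<omega>) x * T \<omega> x)) (at x)"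
proof -
  have "((\<lambda>y. pd b (\<lambda>z. k z y) x) \<longlongrightarrow> expectation (\<lambda>\<omega>. pd b (T \<omega>) x * T \<omega> x)) (at x within G)"
    unfolding tendsto_at_iff_sequentially
  proof (intro allI impI)
    fix y :: "nat \<Rightarrow> real^3"
    assume y: "\<forall>i. y i \<in> G - {x}" "y \<longlonglongrightarrow> x"
    have "(\<lambda>n. expectation (\<lambda>\<omega>. pd b (T \<omega>) x * T \<omega> (y n))) \<longlonglongrightarrow> expectation (\<lambda>\<omega>. pd b (T \<omega>) x * T \<omega> x)"
      using x y by (intro mean_square_lim_prod mean_square_lim_const square_integrable_pd
          mean_square_continuous) auto
    then show "((\<lambda>y. pd b (\<lambda>z. k z y) x) \<circ> y) \<longlonglongrightarrow> expectation (\<lambda>\<omega>. pd b (T \<omega>) x * T \<omega> x)"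
      using x y by (simp add: o_def pd_covariance)
  qed
  then show ?thesis
    using at_within_open[OF x open_domain] by simp
qed

text \<open>This mean is the derivative at 0 of \<open>s \<mapsto> k (x + s e, x)\<close> with
  \<open>e\<close> the axis vector. Stationarity moves the base point to the origin, and isotropy
  under the reflection \<open>uminus\<close> makes the function even, so the derivative equals its
  own negative.\<close>

lemma expectation_pd_mult_field:
  assumes "stationary_kernel k" "isotropic_kernel k" and x: "x \<in> G"
  shows "expectation (\<lambda>\<omega>. pd b (T \<omega>) x * T \<omega> x) = 0"
proof -
  define g where "g s = k (x + s *\<^sub>R axis b 1) x" for s
  have to_origin: "k (x + h) x = k h 0" for h
  proof -
    have "k (h + x) (0 + x) = k h 0"
      using assms(1) unfolding stationary_kernel_def by blast
    then show ?thesis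
      by (simp only: add_0_left add.commute[of h x])
  qed
  have "orthogonal_transformation (uminus :: real^3 \<Rightarrow> real^3)"
    by (simp add: orthogonal_transformation_neg orthogonal_transformation_id)
  then have "k (- h) (- 0) = k h 0" for h
    by (rule assms(2)[unfolded isotropic_kernel_def, rule_format])
  then have k_even: "k (- h) 0 = k h 0" for h
    by (simp only: minus_zero)
  have even: "g (- s) = g s" for s
  proof -
    have "g (- s) = k (- (s *\<^sub>R axis b 1)) 0"
      unfolding g_def to_origin by (simp only: scaleR_minus_left)
    also have "\<dots> = g s"
      unfolding g_def to_origin by (rule k_even)
    finally show ?thesis .
  qed
  have "(g has_real_derivative expectation (\<lambda>\<omega>. pd b (T \<omega>) x * T \<omega> x)) (at 0)"
    unfolding g_def using covariance_has_derivative[OF x x] .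
  \<comment> \<open>The point is written as \<open>- 0\<close> to fit
    \<open>DERIV_mirror\<close>.\<close>
  then have D: "(g has_real_derivative expectation (\<lambda>\<omega>. pd b (T \<omega>) x * T \<omega> x)) (at (- 0))"
    by simp
  then have "((\<lambda>s. g (- s)) has_real_derivative - expectation (\<lambda>\<omega>. pd b (T \<omega>) x * T \<omega> x)) (at 0)"
    by (rule iffD1[OF DERIV_mirror])
  then have "(g has_real_derivative - expectation (\<lambda>\<omega>. pd b (T \<omega>) x * T \<omega> x)) (at (- 0))"
    by (simp add: even)
  from DERIV_unique[OF D this] show ?thesis
    by simp
qed

end

theorem theorem6p3:
  fixes G :: "(real^3) set"
    and \<nu> L RE RE\<^sub>c \<beta> A l :: real
    and u :: "real^3"
    and p :: "real^3 \<Rightarrow> real \<Rightarrow> real"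
    and M :: "'w measure"
    and K :: "real^3 \<Rightarrow> real^3 \<Rightarrow> real \<Rightarrow> real"
    and T :: "'w \<Rightarrow> real^3 \<Rightarrow> real"
    and Z :: "nat \<Rightarrow> real"
    and f :: "nat \<Rightarrow> real^3 \<Rightarrow> real"
    and \<xi> :: "nat \<Rightarrow> 'w \<Rightarrow> real"
  assumes domain: "open G" "connected G" "G \<noteq> {}" "emeasure lborel G < \<infinity>"
    and physical: "\<nu> > 0" "L > 0" "l > 0"
    and reynolds: "RE = norm u * L / \<nu>" "RE > RE\<^sub>c"
    and beta: "\<beta> = 1 / 2"
    and pressure: "\<And>x t. x \<in> G \<Longrightarrow> ((\<lambda>z. p z t) has_derivative (\<lambda>_. 0)) (at x)"
    and prob: "prob_space M"
    and kernel: "stationary_kernel (\<lambda>x y. K x y l)" "isotropic_kernel (\<lambda>x y. K x y l)"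
    and field: "centred_gaussian_field_with_covariance M G T (\<lambda>x y. K x y l)"
    and eigen: "kernel_eigenexpansion G (\<lambda>x y. K x y l) Z f"
    and smooth: "\<And>I. twice_differentiable_on (f I) G"
    and xi: "standard_gaussian_family M \<xi>"
    and kl: "karhunen_loeve M G T Z f \<xi>"
  shows
    "navier_stokes_on G \<nu> (\<lambda>x t. u) p \<and>
     (\<forall>a. \<forall>x\<in>G. \<forall>t. ns_lhs \<nu> (\<lambda>x t. u) a x t = 0) \<and>
     (\<forall>a. \<forall>x\<in>G. \<forall>t.
        (\<integral>\<omega>. ns_lhs \<nu> (turbulent_flow u A RE RE\<^sub>c \<beta> T \<omega>) a x t \<partial>M)
          = (\<Sum>b\<in>UNIV. A\<^sup>2 * u $ b * u $ a * (RE - RE\<^sub>c) powr \<beta> *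
               (\<Sum>I. Z I * f I x * pd b (f I) x)) \<and>
        (\<Sum>b\<in>UNIV. A\<^sup>2 * u $ b * u $ a * (RE - RE\<^sub>c) powr \<beta> *
               (\<Sum>I. Z I * f I x * pd b (f I) x))
          = (\<Sum>b\<in>UNIV. 2 * A\<^sup>2 * u $ b * u $ a * (RE - RE\<^sub>c) powr \<beta> *
               Lim (at x) (\<lambda>y. pd b (\<lambda>z. K z y l) x)) \<and>
        ((\<forall>x y. K x y l = gaussian_kernel x y l) \<longrightarrow>
           (\<Sum>b\<in>UNIV. 2 * A\<^sup>2 * u $ b * u $ a * (RE - RE\<^sub>c) powr \<beta> *
               Lim (at x) (\<lambda>y. pd b (\<lambda>z. K z y l) x)) = 0) \<and>
        integrable M (\<lambda>\<omega>. ns_lhs \<nu> (turbulent_flow u A RE RE\<^sub>c \<beta> T \<omega>) a x t) \<and>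
        (\<forall>b. summable (\<lambda>I. Z I * f I x * pd b (f I) x) \<and>
             (\<forall>y\<in>G. has_pd_at b (\<lambda>z. K z y l) x) \<and>
             ((\<lambda>y. pd b (\<lambda>z. K z y l) x) \<longlongrightarrow>
                Lim (at x) (\<lambda>y. pd b (\<lambda>z. K z y l) x)) (at x)))"
proof -
  interpret prob_space M
    by (rule prob)
  define c where "c = A * (RE - RE\<^sub>c) powr \<beta>"
  have series:
    "mean_square_sums M (\<lambda>I \<omega>. sqrt (Z I) * f I x * \<xi> I \<omega>) (\<lambda>\<omega>. T \<omega> x)"
    "mean_square_sums M (\<lambda>I \<omega>. sqrt (Z I) * pd b (f I) x * \<xi> I \<omega>) (\<lambda>\<omega>. pd b (T \<omega>) x)"
    "mean_square_sums M (\<lambda>I \<omega>. sqrt (Z I) * pd b (pd b (f I)) x * \<xi> I \<omega>)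
       (\<lambda>\<omega>. pd b (pd b (T \<omega>)) x)"
    if "x \<in> G" for x b
    using kl that by (auto simp: karhunen_loeve_def)
  have smooth_T: "twice_differentiable_on (T \<omega>) G" if "\<omega> \<in> space M" for \<omega>
    using kl that by (auto simp: karhunen_loeve_def)
  \<comment> \<open>The mean-square Karhunen-Loeve series supply all second moments.\<close>
  have sq: "square_integrable M (\<lambda>\<omega>. T \<omega> x)" "square_integrable M (\<lambda>\<omega>. pd b (T \<omega>) x)"
    "square_integrable M (\<lambda>\<omega>. pd b (pd b (T \<omega>)) x)" if "x \<in> G" for x b
    using series[OF that, THEN standard_gaussian_series_lim[OF xi]]
    by (auto simp: mean_square_lim_def)
  interpret differentiable_gaussian_field M G T "\<lambda>x y. K x y l"
    using domain(1) field smooth_T sq by unfold_locales (auto simp: twice_differentiable_on_def)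
  have laminar: "ns_lhs \<nu> (\<lambda>x t. u) a x t = 0" for a x t
    by (simp add: ns_lhs_def laplacian_def)
  \<comment> \<open>A vanishing total derivative vanishes along the axis line, and uniqueness of
    derivatives identifies this with \<open>pd\<close>.\<close>
  have "pd a (\<lambda>z. p z t) x = 0" if "x \<in> G" for a x t
  proof -
    have "((\<lambda>s. p (x + s *\<^sub>R axis a 1) t) has_real_derivative pd a (\<lambda>z. p z t) x) (at 0)"
      using pressure[OF that] by (intro has_real_derivative_pd) (auto simp: differentiable_def)
    moreover have line: "((\<lambda>s. x + s *\<^sub>R axis a 1) has_derivative (\<lambda>s. s *\<^sub>R axis a 1)) (at 0)"
      by (auto intro!: derivative_eq_intros)
    then have "((\<lambda>s. p (x + s *\<^sub>R axis a 1) t) has_real_derivative 0) (at 0)"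
      using has_derivative_compose[OF line, of "\<lambda>z. p z t" "\<lambda>_. 0"] pressure[OF that, of t]
      by (simp add: has_field_derivative_def lambda_zero)
    ultimately show ?thesis
      by (rule DERIV_unique)
  qed
  then have laminar_ns: "navier_stokes_on G \<nu> (\<lambda>x t. u) p"
    by (simp add: navier_stokes_on_def laminar)
  have TdT: "expectation (\<lambda>\<omega>. T \<omega> x * pd b (T \<omega>) x) = 0" if "x \<in> G" for b x
    using expectation_pd_mult_field[OF kernel that, of b] by (simp add: mult.commute)
  have eigensum: "(\<lambda>I. Z I * f I x * pd b (f I) x) sums 0" if "x \<in> G" for b x
  proof -
    \<comment> \<open>The series for the field and for its derivative each contribute a factor
      \<open>sqrt (Z I)\<close>; Parseval then equates the eigenfunction series with the mean in
      \<open>TdT\<close>.\<close>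
    have "sqrt (Z I) * f I x * (sqrt (Z I) * pd b (f I) x) = Z I * f I x * pd b (f I) x" for I
    proof -
      have "Z I \<ge> 0"
        using eigen by (simp add: kernel_eigenexpansion_def less_imp_le)
      then have "Z I = sqrt (Z I) * sqrt (Z I)"
        by simp
      then show ?thesis
        by (metis mult.assoc mult.left_commute)
    qed
    then show ?thesis
      using sums_expectation_standard_gaussian_series_mult[OF xi series(1,2)[OF that], of b]
      by (simp only: TdT[OF that])
  qed
  have lim0: "((\<lambda>y. pd b (\<lambda>z. K z y l) x) \<longlongrightarrow> 0) (at x)" if "x \<in> G" for b x
    using pd_covariance_tendsto[OF that, of b] expectation_pd_mult_field[OF kernel that, of b]
    by simp
  \<comment> \<open>\<open>Lim\<close> is a description operator, so its value is known only once
    convergence is proved; uniqueness uses that \<open>at x\<close> is a nontrivial filter.\<close>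
  then have Lim: "Lim (at x) (\<lambda>y. pd b (\<lambda>z. K z y l) x) = 0" if "x \<in> G" for b x
    using that by (intro tendsto_Lim) auto
  \<comment> \<open>Integrability is proved together with the value, so that 0 is a genuine
    expectation and not the default value of the integral.\<close>
  have mean: "integrable M (\<lambda>\<omega>. ns_lhs \<nu> (turbulent_flow u A RE RE\<^sub>c \<beta> T \<omega>) a x t) \<and>
      (\<integral>\<omega>. ns_lhs \<nu> (turbulent_flow u A RE RE\<^sub>c \<beta> T \<omega>) a x t \<partial>M) = 0" if x: "x \<in> G" for a x t
  proof -
    define N where "N \<omega> = (\<Sum>b\<in>UNIV. c * u $ a * u $ b * pd b (T \<omega>) x
        + c\<^sup>2 * u $ a * u $ b * (T \<omega> x * pd b (T \<omega>) x))
      - \<nu> * c * u $ a * (\<Sum>b\<in>UNIV. pd b (pd b (T \<omega>)) x)" for \<omega>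
    \<comment> \<open>The formula is available on \<open>space M\<close>, where the sample paths are
      known to be twice differentiable; this suffices under the integral.\<close>
    have N: "ns_lhs \<nu> (turbulent_flow u A RE RE\<^sub>c \<beta> T \<omega>) a x t = N \<omega>" if "\<omega> \<in> space M" for \<omega>
      using ns_lhs_turbulent_flow[of G T \<omega>, OF domain(1) smooth_T[OF that] x] by (simp add: N_def c_def)
    note int = sq(2,3)[OF x, THEN square_integrable_integrable] square_integrable_prod[OF sq(1)[OF x] sq(2)[OF x]]
    have "integrable M N"
      unfolding N_def by (intro Bochner_Integration.integrable_diff Bochner_Integration.integrable_sum
          Bochner_Integration.integrable_add integrable_mult_right int)
    moreover have "expectation N = 0"
      using series(2,3)[OF x, THEN expectation_standard_gaussian_series[OF xi]]
      unfolding N_def by (simp add: int TdT[OF x])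
    ultimately show ?thesis
      by (simp add: N cong: Bochner_Integration.integrable_cong Bochner_Integration.integral_cong)
  qed
  show ?thesis
    \<comment> \<open>Every expression being compared is now known to be 0, and
      \<open>sums_iff\<close> extracts both summability and the value of the series from
      \<open>eigensum\<close>.\<close>
    using laminar laminar_ns mean eigensum lim0 has_pd_at_covariance
    by (simp add: Lim sums_iff cong del: imp_cong)
qed

end
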